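(* Let $b\ge 3$ be an integer. Let $b=dx$ be any factorization of $b$ into positive integers with $x\ge 2$, and let $b-1=cz$ be any factorization of $b-1$ into positive integers with $c>d$ and $z<x$. Put $y=x-z$, $a=dy$, $m=cy$, $n=cx$. Then $b=n-m+1$ and there exists an $(a,b)$-regular bipartite graph of order $(n,m)$.
   Context: All graphs are finite, simple and undirected. A bipartite graph $G=(U,V;E)$ has color classes $U,V$; it is of order $(n,m)$ if $|U|=n$ and $|V|=m$, and it is $(a,b)$-regular if every vertex of $U$ has degree $a$ and every vertex of $V$ has degree $b$. *)

theory Defs
  imports Main
begin

definition finite_simple_graph :: "'a set \<Rightarrow> 'a set set \<Rightarrow> bool" where
  "finite_simple_graph W E \<longleftrightarrow> finite W \<and> (\<forall>e\<in>E. e \<subseteq> W \<and> card e = 2)"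

definition degree :: "'a set set \<Rightarrow> 'a \<Rightarrow> nat" where
  "degree E v = card {e \<in> E. v \<in> e}"

definition bipartite_graph :: "'a set \<Rightarrow> 'a set \<Rightarrow> 'a set set \<Rightarrow> bool" where
  "bipartite_graph U V E \<longleftrightarrow>
     finite_simple_graph (U \<union> V) E \<and> U \<inter> V = {} \<and>
     (\<forall>e\<in>E. \<exists>u\<in>U. \<exists>v\<in>V. e = {u, v})"

definition has_order :: "'a set \<Rightarrow> 'a set \<Rightarrow> nat \<Rightarrow> nat \<Rightarrow> bool" where
  "has_order U V n m \<longleftrightarrow> card U = n \<and> card V = m"

definition biregular :: "'a set \<Rightarrow> 'a set \<Rightarrow> 'a set set \<Rightarrow> nat \<Rightarrow> nat \<Rightarrow> bool" where
  "biregular U V E a b \<longleftrightarrow> (\<forall>u\<in>U. degree E u = a) \<and> (\<forall>v\<in>V. degree E v = b)"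

end

theory Submission
  imports Defs
begin

text \<open>Number the vertices consecutively, first the \<open>c * x\<close> vertices of \<open>U\<close> and then the \<open>c * y\<close>
  vertices of \<open>V\<close>, and join \<open>u \<in> U\<close> to \<open>v \<in> V\<close> iff \<open>(u + v) mod c < d\<close>. As \<open>d \<le> c\<close>, this condition
  holds for exactly \<open>d\<close> out of any \<open>c\<close> consecutive values of one endpoint, so the degrees are
  \<open>d * y\<close> on \<open>U\<close> and \<open>d * x\<close> on \<open>V\<close>.\<close>

text \<open>Distinct numbers in the interval differ by less than \<open>c\<close>, hence are
  incongruent; an injection between finite sets of size \<open>c\<close> is onto. For
  \<open>c = 0\<close> both sets are empty.\<close>

lemma bij_betw_mod_interval:
  "bij_betw (\<lambda>k. k mod c) {r..<r + c} {..<c}" for c r :: nat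
proof (cases "c = 0")
  case False
  have inj: "inj_on (\<lambda>k. k mod c) {r..<r + c}"
  proof (rule linorder_inj_onI')
    fix i j
    assume "i \<in> {r..<r + c}" "j \<in> {r..<r + c}" "i < j"
    then have "\<not> c dvd j - i"
      by (auto dest: dvd_imp_le)
    then show "i mod c \<noteq> j mod c"
      using \<open>i < j\<close> by (metis less_imp_le mod_eq_dvd_iff_nat)
  qed
  have "(\<lambda>k. k mod c) ` {r..<r + c} = {..<c}"
    by (rule card_subset_eq) (use False in \<open>auto simp: card_image[OF inj]\<close>)
  with inj show ?thesis
    by (simp add: bij_betw_def)
qed (simp add: bij_betw_def)

text \<open>A full period takes each residue once, and \<open>d \<le> c\<close> makes every number
  below \<open>d\<close> a residue.\<close>

lemma card_mod_less_period:
  fixes c d r :: nat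
  assumes "d \<le> c"
  shows "card {k \<in> {r..<r + c}. k mod c < d} = d"
proof -
  have "bij_betw (\<lambda>k. k mod c) {k \<in> {r..<r + c}. k mod c < d} {..<d}"
  proof (rule bij_betw_subset[OF bij_betw_mod_interval[of c r]])
    have "{..<d} \<subseteq> (\<lambda>k. k mod c) ` {r..<r + c}"
      using bij_betw_mod_interval[of c r] assms by (simp add: bij_betw_def)
    then show "(\<lambda>k. k mod c) ` {k \<in> {r..<r + c}. k mod c < d} = {..<d}"
      by fast
  qed auto
  then show ?thesis
    by (auto dest: bij_betw_same_card)
qed

lemma card_mod_less_periods:
  fixes c d q r :: nat
  assumes "d \<le> c"
  shows "card {k \<in> {r..<r + c * q}. k mod c < d} = d * q"
proof (induction q)
  case (Suc q)
  have "{k \<in> {r..<r + c * Suc q}. k mod c < d} =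
      {k \<in> {r..<r + c * q}. k mod c < d} \<union> {k \<in> {r + c * q..<r + c * q + c}. k mod c < d}"
    by auto
  then have "card {k \<in> {r..<r + c * Suc q}. k mod c < d} =
      card {k \<in> {r..<r + c * q}. k mod c < d} +
      card {k \<in> {r + c * q..<r + c * q + c}. k mod c < d}"
    by (simp only:) (rule card_Un_disjoint, simp, simp, fastforce)
  then show ?case
    using Suc.IH card_mod_less_period[OF assms] by simp
qed simp

text \<open>Translation by \<open>s\<close> reduces this to the unshifted count. In the degree
  computation \<open>s\<close> is the fixed vertex and the interval is the opposite class.\<close>

lemma card_shifted_mod_less_periods:
  fixes c d q r s :: nat
  assumes "d \<le> c"
  shows "card {k \<in> {r..<r + c * q}. (s + k) mod c < d} = d * q"
proof -
  have "(+) s ` {k \<in> {r..<r + c * q}. (s + k) mod c < d} =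
      {k \<in> {s + r..<s + r + c * q}. k mod c < d}" (is "_ ` ?A = ?B")
  proof
    show "?B \<subseteq> (+) s ` ?A"
    proof
      fix k assume "k \<in> ?B"
      then show "k \<in> (+) s ` ?A"
        by (intro image_eqI[of _ _ "k - s"]) auto
    qed
  qed auto
  then have "card ?A = card ?B"
    using card_image[OF inj_on_add, of s ?A] by simp
  then show ?thesis
    by (simp only: card_mod_less_periods[OF assms])
qed

text \<open>Disjointness forces the \<open>U\<close>-endpoint of an edge through \<open>u\<close> to
  be \<open>u\<close> itself, so these edges correspond to the neighbours of
  \<open>u\<close>.\<close>

lemma degree_eq_card_neighbours:
  assumes "U \<inter> V = {}" "u \<in> U"
  shows "degree {{u, v} | u v. u \<in> U \<and> v \<in> V \<and> R u v} u = card {v \<in> V. R u v}"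
proof -
  have "{e \<in> {{u, v} | u v. u \<in> U \<and> v \<in> V \<and> R u v}. u \<in> e} = (\<lambda>v. {u, v}) ` {v \<in> V. R u v}"
    using assms by auto
  moreover have "inj_on (\<lambda>v. {u, v}) {v \<in> V. R u v}"
    by (auto simp: inj_on_def doubleton_eq_iff)
  ultimately show ?thesis
    unfolding degree_def by (simp add: card_image)
qed

lemma bipartite_graph_of_relation:
  assumes "finite U" "finite V" "U \<inter> V = {}"
  shows "bipartite_graph U V {{u, v} | u v. u \<in> U \<and> v \<in> V \<and> R u v}"
proof -
  have "card {u, v} = 2" if "u \<in> U" "v \<in> V" for u v
    using that assms(3) by (metis card_2_iff disjoint_iff)
  then show ?thesis
    using assms unfolding bipartite_graph_def finite_simple_graph_def by fast
qed

lemma biregular_bipartite_graph_exists: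
  fixes c d x y :: nat
  assumes "d \<le> c"
  shows "\<exists>(U :: nat set) V E. bipartite_graph U V E \<and> has_order U V (c * x) (c * y) \<and>
    biregular U V E (d * y) (d * x)"
proof -
  \<comment> \<open>The summand \<open>0\<close> gives \<open>U\<close> the shape
    \<open>{r..<r + c * q}\<close> used in the counting lemma.\<close>
  define U V where "U = {0..<0 + c * x}" and "V = {c * x..<c * x + c * y}"
  define E where "E = {{u, v} | u v. u \<in> U \<and> v \<in> V \<and> (u + v) mod c < d}"
  have disj: "U \<inter> V = {}"
    by (auto simp: U_def V_def)
  \<comment> \<open>The degree lemma treats the first class only; exchanging the roles of the
    endpoints makes it apply to \<open>V\<close>.\<close>
  have E_swap: "E = {{v, u} | v u. v \<in> V \<and> u \<in> U \<and> (v + u) mod c < d}"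
    unfolding E_def
    by (intro Collect_cong) (metis (no_types) add.commute insert_commute)
  have "bipartite_graph U V E"
    unfolding E_def using disj by (intro bipartite_graph_of_relation) (auto simp: U_def V_def)
  moreover have "has_order U V (c * x) (c * y)"
    by (simp add: has_order_def U_def V_def)
  moreover have "degree E u = d * y" if "u \<in> U" for u
    unfolding E_def degree_eq_card_neighbours[OF disj that] unfolding V_def
    by (rule card_shifted_mod_less_periods[OF assms])
  moreover have "degree E v = d * x" if "v \<in> V" for v
  proof -
    have "V \<inter> U = {}"
      using disj by blast
    then show ?thesis
      unfolding E_swap degree_eq_card_neighbours[OF \<open>V \<inter> U = {}\<close> that] unfolding U_def
      by (intro card_shifted_mod_less_periods[OF assms])
  qed
  ultimately show ?thesis
    unfolding biregular_def by blast
qed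

theorem proposition4p9:
  fixes b d x c z y a m n :: nat
  assumes "b \<ge> 3"
    and "b = d * x" and "d \<ge> 1" and "x \<ge> 2"
    and "b - 1 = c * z" and "c \<ge> 1" and "z \<ge> 1"
    and "c > d" and "z < x"
    and "y = x - z" and "a = d * y" and "m = c * y" and "n = c * x"
  shows "int b = int n - int m + 1 \<and>
    (\<exists>(U :: nat set) V E.
       bipartite_graph U V E \<and> has_order U V n m \<and> biregular U V E a b)"
proof
  \<comment> \<open>Since \<open>x - y = z\<close>, the difference \<open>n - m\<close> equals
    \<open>c * z\<close>, which is \<open>b - 1\<close>.\<close>
  have "x = y + z"
    using \<open>y = x - z\<close> \<open>z < x\<close> by simp
  then have "n = m + c * z"
    using \<open>m = c * y\<close> \<open>n = c * x\<close> by (simp add: distrib_left)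
  moreover have "b = c * z + 1"
    \<comment> \<open>The bound on \<open>b\<close> excludes \<open>b = 0\<close>, where subtraction
      on \<open>nat\<close> would truncate.\<close>
    using \<open>b - 1 = c * z\<close> \<open>b \<ge> 3\<close> by linarith
  ultimately show "int b = int n - int m + 1"
    by simp
  show "\<exists>(U :: nat set) V E. bipartite_graph U V E \<and> has_order U V n m \<and> biregular U V E a b"
    unfolding \<open>a = d * y\<close> \<open>b = d * x\<close> \<open>m = c * y\<close> \<open>n = c * x\<close>
    using \<open>c > d\<close> by (intro biregular_bipartite_graph_exists less_imp_le)
qed

end
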